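(* Let $m,n\geq 1$, let $[w_1,w_1']$ be an interval in $\mathscr{D}_m$ and $[w_2,w_2']$ an interval in $\mathscr{D}_n$. Then the interval $[w_1,w_1']\,\sharp\,[w_2,w_2']=[w_1\,\sharp\,w_2,\;w_1'\,\sharp\,w_2']$ of $\mathscr{D}_{m+n-1}$ is isomorphic as a poset to the cartesian product of the intervals $[w_1,w_1']$ and $[w_2,w_2']$.
   Context: A Dyck path of size $n\geq 0$ is a word of length $2n$ in the letters $0,1$ with $n$ letters $1$ and $n$ letters $0$ such that every prefix contains at least as many $1$'s as $0$'s (the height after a prefix is its number of $1$'s minus its number of $0$'s). Let $\mathscr{D}_n$ be the set of Dyck paths of size $n$. A subpath of a Dyck path $w$ is a non-empty sequence $x$ of consecutive letters of $w$ that starts and ends at the same height and stays strictly above that height in between. A subpath $x$ is movable in $w$ if it is immediately preceded in $w$ by the letter $0$ and either $x$ ends at the last letter of $w$ or $x$ is immediately followed in $w$ by the letter $1$. For a movable subpath $x$, let $N=N(w,x)\geq 1$ be the number of consecutive letters $0$ just before $x$, so $w=a\,0^{N}\,x\,b$ where $a$ does not end with $0$; for $1\leq i\leq N$ let $M(w,x,i)=a\,0^{N-i}\,x\,0^{i}\,b\in\mathscr{D}_n$. Let $\Gamma_n$ be the directed graph on $\mathscr{D}_n$ with edges $w\to M(w,x,i)$ for all movable $x$ in $w$ and all $1\leq i\leq N(w,x)$. The dexter order is: $u\leq v$ if and only if there is a directed path (possibly of length $0$) from $u$ to $v$ in $\Gamma_n$. This is a partial order whose cover relations are exactly the edges of $\Gamma_n$.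 Product $\sharp$ on non-empty Dyck paths: for a non-empty Dyck path $w$, let $\overline{w}$ be the word obtained by removing its first and last letters (a pseudo-Dyck path; its height, starting at $0$, may reach $-1$). For pseudo-Dyck paths $p,q$, write $p=(p',0^k)$ where $p'$ is empty (if $p$ is empty) or ends with $1$, and $q=q'q''$ where $q'$ is the largest prefix of $q$ in which the height stays $\geq 0$; set $p\ast q=(p',q',0^k,q'')$. Then $u\,\sharp\,v=(1,\overline{u}\ast\overline{v},0)$. This is associative with unit $(1,0)$; if $u\in\mathscr{D}_m$ and $v\in\mathscr{D}_n$ then $u\,\sharp\,v\in\mathscr{D}_{m+n-1}$. Moreover $w_1\leq w_1'$ and $w_2\leq w_2'$ imply $w_1\,\sharp\,w_2\leq w_1'\,\sharp\,w_2'$, so the product of intervals in the claim is well defined. *)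

theory Defs
  imports Main "HOL-Library.Sublist"
begin

datatype letter = Zero | One

type_synonym word = "letter list"

definition height :: "word \<Rightarrow> int" where
  "height w = int (count_list w One) - int (count_list w Zero)"

definition dyck :: "nat \<Rightarrow> word set" where
  "dyck n = {w. length w = 2 * n \<and> count_list w One = n \<and> count_list w Zero = n
                \<and> (\<forall>p. prefix p w \<longrightarrow> count_list p Zero \<le> count_list p One)}"

(* A subpath is an occurrence of x in w, so it is given together with the part c of w
   before it and the part d after it. *)
definition subpath :: "word \<Rightarrow> word \<Rightarrow> word \<Rightarrow> word \<Rightarrow> bool" where
  "subpath w c x d \<longleftrightarrow> w = c @ x @ d \<and> x \<noteq> [] \<and> height (c @ x) = height c
     \<and> (\<forall>p. strict_prefix p x \<and> p \<noteq> [] \<longrightarrow> height c < height (c @ p))"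

definition movable :: "word \<Rightarrow> word \<Rightarrow> word \<Rightarrow> word \<Rightarrow> bool" where
  "movable w c x d \<longleftrightarrow> subpath w c x d \<and> c \<noteq> [] \<and> last c = Zero \<and> (d = [] \<or> hd d = One)"

(* An edge goes from w = a 0^N x b to M(w,x,i) = a 0^(N-i) x 0^i b, where x is movable in w
   and N is the number of consecutive zeros just before x. *)
definition dexter_edge :: "nat \<Rightarrow> word \<Rightarrow> word \<Rightarrow> bool" where
  "dexter_edge n w v \<longleftrightarrow> w \<in> dyck n \<and> v \<in> dyck n \<and>
     (\<exists>a N x b i. movable w (a @ replicate N Zero) x b \<and> (a = [] \<or> last a \<noteq> Zero)
        \<and> 1 \<le> i \<and> i \<le> N \<and> v = a @ replicate (N - i) Zero @ x @ replicate i Zero @ b)"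

definition dexter_le :: "nat \<Rightarrow> word \<Rightarrow> word \<Rightarrow> bool" where
  "dexter_le n u v \<longleftrightarrow> u \<in> dyck n \<and> v \<in> dyck n \<and> (dexter_edge n)\<^sup>*\<^sup>* u v"

definition dexter_interval :: "nat \<Rightarrow> word \<Rightarrow> word \<Rightarrow> word set" where
  "dexter_interval n u v = {w. dexter_le n u w \<and> dexter_le n w v}"

definition trim :: "word \<Rightarrow> word" where
  "trim w = butlast (tl w)"

definition trailing_zeros :: "word \<Rightarrow> word" where
  "trailing_zeros p = rev (takeWhile (\<lambda>l. l = Zero) (rev p))"

definition drop_trailing_zeros :: "word \<Rightarrow> word" where
  "drop_trailing_zeros p = rev (dropWhile (\<lambda>l. l = Zero) (rev p))"

definition nonneg_length :: "word \<Rightarrow> nat" where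
  "nonneg_length q = (GREATEST j. j \<le> length q \<and> (\<forall>i\<le>j. 0 \<le> height (take i q)))"

definition star :: "word \<Rightarrow> word \<Rightarrow> word" where
  "star p q = drop_trailing_zeros p @ take (nonneg_length q) q
     @ trailing_zeros p @ drop (nonneg_length q) q"

(* Meaningful only for non-empty Dyck paths. *)
definition sharp :: "word \<Rightarrow> word \<Rightarrow> word" where
  "sharp u v = [One] @ star (trim u) (trim v) @ [Zero]"

definition poset_isomorphic ::
  "'a set \<Rightarrow> ('a \<Rightarrow> 'a \<Rightarrow> bool) \<Rightarrow> 'b set \<Rightarrow> ('b \<Rightarrow> 'b \<Rightarrow> bool) \<Rightarrow> bool" where
  "poset_isomorphic A leA B leB \<longleftrightarrow>
     (\<exists>f. bij_betw f A B \<and> (\<forall>x\<in>A. \<forall>y\<in>A. leA x y \<longleftrightarrow> leB (f x) (f y)))"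

end

theory Submission
  imports Defs
begin

text \<open>
  Write \<open>u = A 0\<^sup>j\<close> with \<open>A\<close> ending in \<open>1\<close>, and \<open>v = 1 q 0 s\<close> with \<open>q\<close>, \<open>s\<close> Dyck paths; then
  \<open>u \<sharp> v = A q 0\<^sup>j s\<close>. For \<open>u\<close> of size \<open>m\<close>, the prefix \<open>A\<close> is recovered from the product as the
  prefix ending at the \<open>m\<close>-th letter \<open>1\<close>, so \<open>\<sharp>\<close> is injective. Every edge between products is an edge in
  exactly one factor, and conversely; moreover an edge ending in a product starts in a product:
  after \<open>A\<close> a general path reads \<open>q\<^sub>0 0 q\<^sub>1 0 \<dots> 0 q\<^sub>j\<close> with Dyck paths \<open>q\<^sub>i\<close>, and no edge can make
  all of \<open>q\<^sub>1, \<dots>, q\<^sub>j\<^sub>-\<^sub>1\<close> empty when one of them is not. So the products form a down-set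
  on which the dexter order is the product order.
\<close>

section \<open>Heights along words, and cutting words at runs of zeros and first descents\<close>

abbreviation zeros :: "nat \<Rightarrow> word" where
  "zeros i \<equiv> replicate i Zero"

text \<open>\<open>run h w\<close> is the height reached by \<open>w\<close> from height \<open>h\<close>, undefined if \<open>w\<close> goes below 0.\<close>

fun run :: "nat \<Rightarrow> word \<Rightarrow> nat option" where
  "run h [] = Some h"
| "run h (One # w) = run (Suc h) w"
| "run 0 (Zero # w) = None"
| "run (Suc h) (Zero # w) = run h w"

abbreviation dyck_word :: "word \<Rightarrow> bool" where
  "dyck_word w \<equiv> run 0 w = Some 0"

abbreviation no_leading_zero :: "word \<Rightarrow> bool" where
  "no_leading_zero b \<equiv> b = [] \<or> hd b = One"

lemma run_append [simp]: "run h (u @ v) = Option.bind (run h u) (\<lambda>k. run k v)"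
  by (induction h u rule: run.induct) auto

lemma run_zeros [simp]: "run h (zeros i) = (if i \<le> h then Some (h - i) else None)"
proof (induction i arbitrary: h)
  case (Suc i)
  then show ?case by (cases h) auto
qed simp

lemma run_shift: "run h w = Some k \<Longrightarrow> run (h + d) w = Some (k + d)"
  by (induction h w rule: run.induct) auto

lemma run_dyck_word: "dyck_word w \<Longrightarrow> run h w = Some h"
  using run_shift[of 0 w 0 h] by simp

lemma dyck_word_no_leading_zero: "dyck_word w \<Longrightarrow> no_leading_zero w"
  by (cases "(0 :: nat, w)" rule: run.cases) auto

lemma dyck_word_last:
  assumes "dyck_word w" "w \<noteq> []"
  shows "last w = Zero"
proof (cases w rule: rev_cases)
  case (snoc w' x)
  with assms(1) show ?thesis by (cases "run 0 w'"; cases x) auto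
qed (use assms(2) in simp)

lemma run_append_zeros_eq_0:
  assumes "run h (w @ zeros j) = Some 0"
  shows "run h w = Some j"
  using assms by (cases "run h w") (auto split: if_splits)

lemma dyck_word_append_zeros:
  assumes "dyck_word (zeros i @ w)"
  shows "i = 0"
  using assms by (auto split: if_splits)

lemma zeros_append_cancel:
  assumes "zeros i @ b = zeros j @ s" "no_leading_zero b" "no_leading_zero s"
  shows "i = j \<and> b = s"
  using assms
proof (induction i arbitrary: j)
  case 0
  then show ?case by (cases j) auto
next
  case (Suc i)
  then show ?case by (cases j) auto
qed

text \<open>The cases record whether the cut between \<open>u\<close> and \<open>t\<close> lies
  strictly inside \<open>zeros i\<close>; a cut exactly at its end is the first case with
  \<open>b'\<close> empty.\<close>

lemma zeros_append_eq_append: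
  assumes "zeros i @ b = u @ t"
  obtains b' where "u = zeros i @ b'" "b = b' @ t"
  | i' where "i' < i" "u = zeros i'" "t = zeros (i - i') @ b"
proof -
  have "(\<exists>b'. u = zeros i @ b' \<and> b = b' @ t) \<or> (\<exists>i'<i. u = zeros i' \<and> t = zeros (i - i') @ b)"
    using assms
  proof (induction i arbitrary: u)
    case (Suc i)
    show ?case
    proof (cases u)
      case Nil
      with Suc.prems show ?thesis by (intro disjI2 exI[of _ 0]) simp
    next
      case (Cons a u')
      with Suc.prems have a: "a = Zero" and "zeros i @ b = u' @ t" by auto
      from Suc.IH[OF this(2)] show ?thesis
      proof (elim disjE exE conjE)
        fix i' assume "i' < i" "u' = zeros i'" "t = zeros (i - i') @ b"
        then show ?thesis using Cons a by (intro disjI2 exI[of _ "Suc i'"]) simp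
      qed (use Cons a in auto)
    qed
  qed simp
  then show thesis using that by blast
qed

text \<open>\<open>q\<close> ends just before the path first goes below its starting height, so the
  whole word determines it.\<close>

lemma dyck_word_Zero_cancel:
  assumes "dyck_word q" "dyck_word q'" "q @ Zero # s = q' @ Zero # s'"
  shows "q = q' \<and> s = s'"
proof -
  have *: "u = []" if "dyck_word p" "dyck_word (p @ u)" "u @ Zero # t = Zero # t'" for p u t t'
    using that by (cases u) auto
  from assms(3) obtain u where
    "q = q' @ u \<and> u @ Zero # s = Zero # s' \<or> q @ u = q' \<and> Zero # s = u @ Zero # s'"
    by (auto simp: append_eq_append_conv2)
  then show ?thesis
    using *[of q' u s s'] *[of q u s' s] assms(1,2) by auto
qed

text \<open>If the word begins with \<open>One\<close>, the induction hypothesis applies twice: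
  first to close the arch opened there, then to the rest.\<close>

lemma first_return:
  assumes "run (Suc h) w = Some 0"
  obtains q s where "w = q @ Zero # s" "dyck_word q" "run h s = Some 0"
proof -
  have "\<exists>q s. w = q @ Zero # s \<and> dyck_word q \<and> run h s = Some 0"
    using assms
  proof (induction "length w" arbitrary: w h rule: less_induct)
    case less
    show ?case
    proof (cases w)
      case Nil
      with less.prems show ?thesis by simp
    next
      case (Cons l v)
      show ?thesis
      proof (cases l)
        case Zero
        with Cons less.prems show ?thesis by (intro exI[of _ "[]"] exI[of _ v]) simp
      next
        case One
        with Cons less.prems have "run (Suc (Suc h)) v = Some 0" by simp
        from less.hyps[OF _ this] Cons obtain q s where
          q: "v = q @ Zero # s" "dyck_word q" "run (Suc h) s = Some 0" by auto
        from less.hyps[OF _ q(3)] Cons q(1) obtain q' s' where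
          q': "s = q' @ Zero # s'" "dyck_word q'" "run h s' = Some 0" by auto
        have "w = (One # q @ Zero # q') @ Zero # s'" using Cons One q q' by simp
        moreover have "dyck_word (One # q @ Zero # q')"
          using q(2) q'(2) by (simp add: run_dyck_word)
        ultimately show ?thesis using q'(3) by blast
      qed
    qed
  qed
  then show thesis using that by blast
qed

section \<open>Translation of the height conditions into \<open>run\<close>\<close>

lemma height_simps [simp]:
  "height [] = 0" "height (One # w) = height w + 1" "height (Zero # w) = height w - 1"
  "height (u @ v) = height u + height v"
  by (auto simp: height_def)

lemma run_eq_Some_iff:
  "run h w = Some k \<longleftrightarrow> int h + height w = int k \<and> (\<forall>p. prefix p w \<longrightarrow> 0 \<le> int h + height p)"
proof (induction h w rule: run.induct)
  case (2 h w)
  have "(\<forall>p. prefix p (One # w) \<longrightarrow> 0 \<le> int h + height p) \<longleftrightarrow>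
        (\<forall>p. prefix p w \<longrightarrow> 0 \<le> int (Suc h) + height p)"
    by (auto simp: prefix_Cons algebra_simps)
  with 2 show ?case by auto
next
  case (3 w)
  have "prefix [Zero] (Zero # w)" by simp
  then have "\<not> (\<forall>p. prefix p (Zero # w) \<longrightarrow> 0 \<le> int 0 + height p)"
    by (auto intro!: exI[of _ "[Zero]"])
  then show ?case by auto
next
  case (4 h w)
  have "(\<forall>p. prefix p (Zero # w) \<longrightarrow> 0 \<le> int (Suc h) + height p) \<longleftrightarrow>
        (\<forall>p. prefix p w \<longrightarrow> 0 \<le> int h + height p)"
    by (auto simp: prefix_Cons algebra_simps)
  with 4 show ?case by auto
qed auto

lemma count_list_length: "count_list w One + count_list w Zero = length w"
proof (induction w)
  case (Cons a w)
  then show ?case by (cases a) auto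
qed simp

lemma dyck_iff: "w \<in> dyck n \<longleftrightarrow> dyck_word w \<and> length w = 2 * n"
  using count_list_length[of w] by (auto simp: dyck_def run_eq_Some_iff height_def)

text \<open>A subpath is a single arch: as it stays strictly above its base, the first letter goes
  up, the last comes down, and the part between never falls below height 1 over the base.\<close>

lemma subpath_iff:
  "subpath w c x d \<longleftrightarrow> w = c @ x @ d \<and> (\<exists>y. x = One # y @ [Zero] \<and> dyck_word y)"
proof (intro iffI; (elim conjE exE)?)
  assume *: "subpath w c x d"
  then have w: "w = c @ x @ d" and ne: "x \<noteq> []" and h: "height x = 0"
    and pos: "\<And>p. strict_prefix p x \<Longrightarrow> p \<noteq> [] \<Longrightarrow> 0 < height p"
    by (auto simp: subpath_def)
  from ne obtain l x' where x': "x = l # x'" by (cases x) auto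
  with h have "x' \<noteq> []" by (cases l) auto
  then obtain y z where x: "x = l # y @ [z]" using x' by (cases x' rule: rev_cases) auto
  have "0 < height [l]" by (rule pos) (auto simp: x strict_prefix_def)
  then have l: "l = One" by (cases l) auto
  have "0 < height (One # y)" by (rule pos) (auto simp: x l strict_prefix_def)
  with h have z: "z = Zero" by (cases z) (auto simp: x l)
  have "0 \<le> height p" if "prefix p y" for p
  proof -
    have "p \<noteq> y @ [z]" using prefix_length_le[OF that] by auto
    with pos[of "One # p"] that show ?thesis by (simp add: x l strict_prefix_def)
  qed
  then have "dyck_word y" using h by (auto simp: run_eq_Some_iff x l z)
  then show "w = c @ x @ d \<and> (\<exists>y. x = One # y @ [Zero] \<and> dyck_word y)"
    using w x l z by auto
next
  fix y assume *: "w = c @ x @ d" "x = One # y @ [Zero]" "dyck_word y"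
  have "0 < height p" if "strict_prefix p x" "p \<noteq> []" for p
  proof -
    from that have "prefix p (One # y)"
      by (auto simp: *(2) strict_prefix_def prefix_Cons)
    with that(2) obtain p' where "p = One # p'" "prefix p' y" by (auto simp: prefix_Cons)
    then show ?thesis using *(3) by (auto simp: run_eq_Some_iff)
  qed
  moreover have "height y = 0" using *(3) by (auto simp: run_eq_Some_iff)
  ultimately show "subpath w c x d" by (simp add: subpath_def *(1,2))
qed

section \<open>Dexter edges as slides of arches across zeros\<close>

text \<open>A dexter edge without the maximality of the run of zeros, which is redundant: the remaining
  zeros can be absorbed into \<open>c\<close>.\<close>

inductive slide :: "word \<Rightarrow> word \<Rightarrow> bool" where
  slide: "\<lbrakk>0 < i; dyck_word y; no_leading_zero b\<rbrakk> \<Longrightarrow>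
    slide (c @ zeros i @ One # y @ Zero # b) (c @ One # y @ Zero # zeros i @ b)"

text \<open>An arch can be crossed from any height and returns to it, so \<open>run\<close> gives
  the same result whether the zeros come before or after it.\<close>

lemma slide_dyck_word_iff: "slide w v \<Longrightarrow> dyck_word w \<longleftrightarrow> dyck_word v"
proof (induction rule: slide.induct)
  case (slide i y b c)
  then show ?case
    by (cases "run 0 c") (auto simp: run_dyck_word)
qed

lemma slide_length: "slide w v \<Longrightarrow> length w = length v"
  by (induction rule: slide.induct) auto

lemma slide_dyck_iff: "slide w v \<Longrightarrow> w \<in> dyck n \<longleftrightarrow> v \<in> dyck n"
  by (simp add: dyck_iff slide_dyck_word_iff slide_length)

lemma split_trailing_zeros:
  obtains a k where "c = a @ zeros k" "a = [] \<or> last a = One"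
proof -
  have "\<exists>a k. c = a @ zeros k \<and> (a = [] \<or> last a = One)"
  proof (induction c rule: rev_induct)
    case (snoc x c)
    show ?case
    proof (cases x)
      case Zero
      from snoc obtain a k where "c = a @ zeros k" "a = [] \<or> last a = One" by blast
      then show ?thesis using Zero
        by (intro exI[of _ a] exI[of _ "Suc k"]) (simp add: replicate_append_same)
    next
      case One
      then show ?thesis by (intro exI[of _ "c @ [x]"] exI[of _ 0]) simp
    qed
  qed simp
  then show thesis using that by blast
qed

lemma dexter_edge_iff: "dexter_edge n w v \<longleftrightarrow> w \<in> dyck n \<and> slide w v"
proof
  assume "dexter_edge n w v"
  then obtain a N x b i where w: "w \<in> dyck n" and mv: "movable w (a @ zeros N) x b"
    and i: "1 \<le> i" "i \<le> N" and v: "v = a @ zeros (N - i) @ x @ zeros i @ b"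
    unfolding dexter_edge_def by blast
  from mv obtain y where w': "w = (a @ zeros N) @ x @ b" and y: "x = One # y @ [Zero]" "dyck_word y"
    and b: "no_leading_zero b"
    by (auto simp: movable_def subpath_iff)
  \<comment> \<open>The \<open>N - i\<close> zeros that stay in front of the arch become part of the
    context \<open>c\<close>.\<close>
  have "zeros N = zeros (N - i) @ zeros i" using i by (simp flip: replicate_add)
  then have "slide w v"
    using slide.slide[of i y b "a @ zeros (N - i)"] i y b w' v by simp
  with w show "w \<in> dyck n \<and> slide w v" by blast
next
  assume "w \<in> dyck n \<and> slide w v"
  then have w: "w \<in> dyck n" and v: "v \<in> dyck n" and sl: "slide w v"
    using slide_dyck_iff by blast+
  from sl obtain i y b c where *: "0 < i" "dyck_word y" "no_leading_zero b"
    "w = c @ zeros i @ One # y @ Zero # b" "v = c @ One # y @ Zero # zeros i @ b"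
    by cases blast
  \<comment> \<open>The zeros ending \<open>c\<close> complete the \<open>i\<close> moved ones to
    the maximal run, of length \<open>k + i\<close>.\<close>
  obtain a k where c: "c = a @ zeros k" "a = [] \<or> last a = One" by (rule split_trailing_zeros)
  have "movable w (a @ zeros (k + i)) (One # y @ [Zero]) b"
    using * c by (auto simp: movable_def subpath_iff replicate_add)
  then show "dexter_edge n w v"
    unfolding dexter_edge_def using w v * c
    by (intro conjI exI[of _ a] exI[of _ "k + i"] exI[of _ "One # y @ [Zero]"] exI[of _ b] exI[of _ i])
      auto
qed

text \<open>Slides preserve \<open>dyck n\<close>, so membership at the start of a path settles it
  everywhere.\<close>

lemma dexter_le_iff: "dexter_le n u v \<longleftrightarrow> u \<in> dyck n \<and> slide\<^sup>*\<^sup>* u v"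
proof
  assume "dexter_le n u v"
  then have "u \<in> dyck n" "(dexter_edge n)\<^sup>*\<^sup>* u v" by (auto simp: dexter_le_def)
  moreover have "dexter_edge n \<le> slide" by (auto simp: dexter_edge_iff)
  ultimately show "u \<in> dyck n \<and> slide\<^sup>*\<^sup>* u v"
    using rtranclp_mono[of "dexter_edge n" slide] by blast
next
  assume "u \<in> dyck n \<and> slide\<^sup>*\<^sup>* u v"
  then have u: "u \<in> dyck n" and "slide\<^sup>*\<^sup>* u v" by auto
  from this(2) have "v \<in> dyck n \<and> (dexter_edge n)\<^sup>*\<^sup>* u v"
  proof (induction rule: rtranclp_induct)
    case (step y z)
    then show ?case
      using slide_dyck_iff dexter_edge_iff by (meson rtranclp.rtrancl_into_rtrancl)
  qed (use u in simp)
  with u show "dexter_le n u v" by (simp add: dexter_le_def)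
qed

section \<open>Decomposition of the factors and an explicit formula for the product\<close>

lemma last_descent:
  assumes "w \<in> dyck n" "n \<ge> 1"
  obtains A j where "w = A @ zeros j" "A \<noteq> []" "last A = One" "run 0 A = Some j" "j \<ge> 1"
proof -
  obtain A j where A: "w = A @ zeros j" "A = [] \<or> last A = One" by (rule split_trailing_zeros)
  have w: "dyck_word w" "w \<noteq> []" using assms by (auto simp: dyck_iff)
  then have ne: "A \<noteq> []" using A(1) by (auto split: if_splits)
  then have l: "last A = One" using A by simp
  have rA: "run 0 A = Some j" using w(1) A(1) run_append_zeros_eq_0 by blast
  then have "j \<noteq> 0" using dyck_word_last[of A] ne l by auto
  then show thesis using that[OF A(1) ne l rA] by simp
qed

lemma first_block:
  assumes "w \<in> dyck n" "n \<ge> 1"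
  obtains q s where "w = One # q @ Zero # s" "dyck_word q" "dyck_word s"
proof -
  from assms have w: "dyck_word w" "w \<noteq> []" by (auto simp: dyck_iff)
  then obtain v where v: "w = One # v" using dyck_word_no_leading_zero[of w] by (cases w) auto
  then have "run (Suc 0) v = Some 0" using w by simp
  from first_return[OF this] show thesis using v that by blast
qed

text \<open>For a Dyck path \<open>A @ zeros j\<close>, \<open>A\<close> ends at the last
  \<open>One\<close>, and \<open>j\<close> is both the height there and the length of the final
  descent.\<close>

abbreviation ascent_part :: "word \<Rightarrow> nat \<Rightarrow> bool" where
  "ascent_part A j \<equiv> run 0 A = Some j \<and> A \<noteq> [] \<and> last A = One"

text \<open>Since \<open>q\<close> returns to height 0, a following \<open>Zero\<close> leads to -1;
  this identifies the part of the right factor that the product moves in front of the zeros.\<close>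

lemma nonneg_length_append_Zero:
  assumes "dyck_word q" "s = [] \<or> hd s = Zero"
  shows "nonneg_length (q @ s) = length q"
  unfolding nonneg_length_def
proof (rule Greatest_equality)
  have "0 \<le> height (take i q)" for i
    using assms(1) take_is_prefix by (auto simp: run_eq_Some_iff)
  then show "length q \<le> length (q @ s) \<and> (\<forall>i\<le>length q. 0 \<le> height (take i (q @ s)))"
    by simp
next
  fix k assume k: "k \<le> length (q @ s) \<and> (\<forall>i\<le>k. 0 \<le> height (take i (q @ s)))"
  show "k \<le> length q"
  proof (rule ccontr)
    assume "\<not> k \<le> length q"
    with k have "Suc (length q) \<le> k" "s \<noteq> []" by auto
    with k have "0 \<le> height (take (Suc (length q)) (q @ s))" by blast
    moreover from \<open>s \<noteq> []\<close> assms(2) obtain s' where "s = Zero # s'" by (cases s) auto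
    ultimately show False using assms(1) by (auto simp: run_eq_Some_iff)
  qed
qed

lemma trailing_zeros_append:
  assumes "A = [] \<or> last A = One"
  shows "trailing_zeros (A @ zeros j) = zeros j" "drop_trailing_zeros (A @ zeros j) = A"
proof -
  have "takeWhile (\<lambda>l. l = Zero) (rev A) = []" "dropWhile (\<lambda>l. l = Zero) (rev A) = rev A"
    using assms by (cases A rule: rev_cases; simp)+
  then show "trailing_zeros (A @ zeros j) = zeros j" "drop_trailing_zeros (A @ zeros j) = A"
    by (simp_all add: trailing_zeros_def drop_trailing_zeros_def takeWhile_append dropWhile_append)
qed

text \<open>Trimming costs the left factor one zero of its final descent, and the
  \<open>Zero\<close> after \<open>q\<close> takes its place. The last letter of the right factor is
  trimmed and put back by \<open>sharp\<close>.\<close>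

lemma sharp_eq:
  assumes "ascent_part A j" "dyck_word q" "dyck_word s"
  shows "sharp (A @ zeros j) (One # q @ Zero # s) = A @ q @ zeros j @ s"
proof -
  obtain A' where A: "A = One # A'" "A' = [] \<or> last A' = One"
    using assms(1) by (cases "(0 :: nat, A)" rule: run.cases) (auto split: if_splits)
  have "j \<noteq> 0" using dyck_word_last[of A] assms(1) by auto
  then obtain k where j: "j = Suc k" by (cases j) auto
  have "A @ zeros j = One # (A' @ zeros k) @ [Zero]"
    by (simp add: A(1) j replicate_append_same)
  then have 1: "trim (A @ zeros j) = A' @ zeros k"
    unfolding trim_def by (simp only: list.sel butlast_snoc)
  \<comment> \<open>\<open>t\<close> is empty if \<open>s\<close> is; otherwise it starts with the
    \<open>Zero\<close> that takes the trimmed right factor below height 0.\<close>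
  define t where "t = butlast (Zero # s)"
  have t: "t = [] \<or> hd t = Zero" "t @ [Zero] = Zero # s"
    using dyck_word_last[OF assms(3)] append_butlast_last_id[of s] by (auto simp: t_def)
  have 2: "trim (One # q @ Zero # s) = q @ t"
    by (simp add: trim_def t_def butlast_append)
  show ?thesis
    unfolding sharp_def star_def 1 2 trailing_zeros_append[OF A(2)]
      nonneg_length_append_Zero[OF assms(2) t(1)]
    using t(2) by (simp add: A(1) j flip: replicate_append_same)
qed

section \<open>Slides into and out of products\<close>

lemma trailing_zeros_unique:
  assumes "A @ zeros j = B @ zeros k" "A \<noteq> []" "last A = One" "B \<noteq> []" "last B = One"
  shows "A = B \<and> j = k"
proof -
  have "zeros j @ rev A = zeros k @ rev B" using arg_cong[OF assms(1), of rev] by simp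
  from zeros_append_cancel[OF this] show ?thesis using assms by (auto simp: hd_rev)
qed

text \<open>Started at a positive height, \<open>p\<close> falls to 0, which no prefix of the Dyck
  word \<open>y\<close> can do; hence \<open>y\<close> and the \<open>Zero\<close> closing its arch
  fit inside \<open>p\<close>.\<close>

lemma arch_within:
  assumes "y @ Zero # r = p @ t" "dyck_word y" "run (Suc h) p = Some 0"
  obtains p' where "p = y @ Zero # p'" "r = p' @ t"
proof -
  from assms(1) obtain u where
    "y = p @ u \<and> u @ Zero # r = t \<or> y @ u = p \<and> Zero # r = u @ t"
    by (auto simp: append_eq_append_conv2)
  then show thesis
  proof (elim disjE conjE)
    assume "y = p @ u"
    with assms(2) obtain k where "run 0 p = Some k" by (cases "run 0 p") auto
    from run_shift[OF this, of "Suc h"] assms(3) show thesis by simp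
  next
    assume u: "y @ u = p" "Zero # r = u @ t"
    with assms(3) run_dyck_word[OF assms(2)] have "u \<noteq> []" by auto
    with u that show thesis by (cases u) auto
  qed
qed

text \<open>An arch that starts inside \<open>A\<close> and ends beyond it must swallow \<open>q\<close>.\<close>

lemma arch_across:
  assumes "y @ Zero # r = q @ zeros j @ s" "dyck_word q" "run l y = Some 0" "l < j"
  shows "y = q @ zeros l"
proof -
  from assms(1) obtain u where
    "y = q @ u \<and> u @ Zero # r = zeros j @ s \<or> y @ u = q \<and> Zero # r = u @ zeros j @ s"
    by (auto simp: append_eq_append_conv2)
  then show ?thesis
  proof (elim disjE conjE)
    assume u: "y = q @ u" "u @ Zero # r = zeros j @ s"
    have ru: "run l u = Some 0" using u(1) assms(3) run_dyck_word[OF assms(2)] by simp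
    from u(2)[symmetric] show ?thesis
    proof (cases rule: zeros_append_eq_append)
      case (1 b')
      with ru assms(4) show ?thesis by simp
    next
      case (2 i')
      with ru u(1) show ?thesis by (auto split: if_splits)
    qed
  next
    assume u: "y @ u = q" "Zero # r = u @ zeros j @ s"
    have "run l (y @ u) = Some l" using run_dyck_word[OF assms(2)] u(1) by simp
    then have "run 0 u = Some l" using assms(3) by simp
    with u(2) have "u = []" by (cases u) auto
    with u \<open>run 0 u = Some l\<close> show ?thesis by simp
  qed
qed

text \<open>If the arch moved in \<open>u\<close> is followed by a \<open>One\<close>, it lies in
  the ascent part. If it ends \<open>u\<close>, it contains the last \<open>One\<close>, so the
  product puts \<open>q\<close> inside it; the larger arch is followed by \<open>s\<close>, which
  has no leading zero.\<close>

lemma slide_sharp_left: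
  assumes "slide u v" "u \<in> dyck m" "m \<ge> 1" "w \<in> dyck n" "n \<ge> 1"
  shows "slide (sharp u w) (sharp v w)"
proof -
  obtain q s where w: "w = One # q @ Zero # s" and qs: "dyck_word q" "dyck_word s"
    using first_block[OF assms(4,5)] .
  obtain A j where u: "u = A @ zeros j" and A: "ascent_part A j"
    using last_descent[OF assms(2,3)] by metis
  have dv: "dyck_word v" using assms(1,2) slide_dyck_iff dyck_iff by blast
  from assms(1) obtain i y b c where *: "0 < i" "dyck_word y" "no_leading_zero b"
    "u = c @ zeros i @ One # y @ Zero # b" "v = c @ One # y @ Zero # zeros i @ b"
    by cases blast
  show ?thesis
  proof (cases "b = []")
    case True
    \<comment> \<open>Splitting \<open>One # y\<close> rather than \<open>y\<close> gives a last
      \<open>One\<close> even when \<open>y\<close> is empty.\<close>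
    obtain a k where "One # y = a @ zeros k" "a = [] \<or> last a = One"
      by (rule split_trailing_zeros)
    then obtain y1 where y: "y = y1 @ zeros k" and y1: "last (One # y1) = One"
      by (cases a) (auto simp: Cons_replicate_eq)
    let ?A = "c @ zeros i @ One # y1" and ?B = "c @ One # y1"
    have "?A @ zeros (Suc k) = A @ zeros j"
      using * True u y by (simp add: replicate_append_same)
    from trailing_zeros_unique[OF this] A y1 have A': "A = ?A" "j = Suc k"
      by auto
    have v: "v = ?B @ zeros (j + i)"
      using * True y A' by (simp add: replicate_append_same replicate_add)
    have "run 0 y1 = Some k" using *(2) y by (cases "run 0 y1") (auto split: if_splits)
    then have dy: "dyck_word (y1 @ q @ zeros k)" using qs(1) by (simp add: run_dyck_word)
    have "ascent_part ?B (j + i)"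
      using run_append_zeros_eq_0[OF dv[unfolded v]] y1 by simp
    then have "sharp v w = ?B @ q @ zeros (j + i) @ s"
      unfolding v w using qs by (intro sharp_eq)
    moreover have "sharp u w = ?A @ q @ zeros j @ s"
      unfolding u w A'(1)[symmetric] using A qs by (intro sharp_eq)
    ultimately show ?thesis
      using slide.slide[OF *(1) dy dyck_word_no_leading_zero[OF qs(2)], of c]
      by (simp add: A'(2) replicate_app_Cons_same replicate_add)
  next
    case False
    let ?C = "c @ zeros i @ One # y @ [Zero]"
    have "A @ zeros j = ?C @ b" using * u by simp
    then obtain b' where "A = ?C @ b' \<and> b' @ zeros j = b \<or> A @ b' = ?C \<and> zeros j = b' @ b"
      unfolding append_eq_append_conv2 by blast
    \<comment> \<open>If \<open>A\<close> stopped within \<open>?C\<close>, then \<open>b\<close>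
      would consist of zeros, but it begins with \<open>One\<close>.\<close>
    moreover have "zeros j \<noteq> b' @ b"
    proof
      assume "zeros j = b' @ b"
      then have "set b \<subseteq> {Zero}" by (metis set_append set_replicate_conv_if Un_upper2 empty_subsetI order_trans)
      with False *(3) show False by (cases b) auto
    qed
    ultimately have b': "A = ?C @ b'" "b = b' @ zeros j" by auto
    with A have ne: "b' \<noteq> []" by auto
    then have h: "no_leading_zero (b' @ q @ zeros j @ s)" using *(3) b'(2) by auto
    let ?B = "c @ One # y @ Zero # zeros i @ b'"
    have v: "v = ?B @ zeros j" using * b' by simp
    have "ascent_part ?B j"
      using run_append_zeros_eq_0[OF dv[unfolded v]] A ne b'(1) by simp
    then have "sharp v w = ?B @ q @ zeros j @ s"
      unfolding v w using qs by (intro sharp_eq)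
    moreover have "sharp u w = A @ q @ zeros j @ s"
      unfolding u w using A qs by (intro sharp_eq)
    ultimately show ?thesis
      using slide.slide[OF *(1,2) h, of c] by (simp add: b'(1))
  qed
qed

text \<open>The moved arch lies inside \<open>q\<close>, or inside \<open>s\<close> together with
  the zeros it crosses, or it is the first arch of \<open>s\<close>. In the last case it crosses the
  \<open>Zero\<close> after \<open>q\<close> and some zeros ending \<open>q\<close>; the product
  replaces that \<open>Zero\<close> by \<open>zeros j\<close>, and the slide crosses all of
  them.\<close>

lemma slide_sharp_right:
  assumes "slide u v" "u \<in> dyck n" "n \<ge> 1" "w \<in> dyck m" "m \<ge> 1"
  shows "slide (sharp w u) (sharp w v)"
proof -
  obtain q s where u: "u = One # q @ Zero # s" and qs: "dyck_word q" "dyck_word s"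
    using first_block[OF assms(2,3)] .
  obtain A j where w: "w = A @ zeros j" and A: "ascent_part A j" and j: "j \<ge> 1"
    using last_descent[OF assms(4,5)] by metis
  have dv: "dyck_word v" using assms(1,2) slide_dyck_iff dyck_iff by blast
  have su: "sharp w u = A @ q @ zeros j @ s"
    unfolding w u using A qs by (intro sharp_eq)
  from assms(1) obtain i y b c0 where *: "0 < i" "dyck_word y" "no_leading_zero b"
    "u = c0 @ zeros i @ One # y @ Zero # b" "v = c0 @ One # y @ Zero # zeros i @ b"
    by cases blast
  \<comment> \<open>At least one zero precedes the arch, so the initial \<open>One\<close> of
    \<open>u\<close> belongs to \<open>c0\<close>.\<close>
  obtain c where c0: "c0 = One # c"
    using * u by (cases c0; cases i) auto
  have "(c @ zeros i) @ One # y @ Zero # b = q @ Zero # s" using * u c0 by simp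
  then obtain p where "c @ zeros i = q @ p \<and> p @ One # y @ Zero # b = Zero # s \<or>
      (c @ zeros i) @ p = q \<and> One # y @ Zero # b = p @ Zero # s"
    unfolding append_eq_append_conv2 by blast
  then show ?thesis
  proof (elim disjE conjE)
    assume p: "(c @ zeros i) @ p = q" "One # y @ Zero # b = p @ Zero # s"
    then obtain p' where p': "p = One # p'" "y @ Zero # b = p' @ Zero # s" by (cases p) auto
    from qs(1) p(1) p'(1) obtain h where "run (Suc h) p' = Some 0"
      by (cases "run 0 c") (auto split: if_splits)
    from arch_within[OF p'(2) *(2) this] obtain b' where b': "p' = y @ Zero # b'" "b = b' @ Zero # s" .
    then have h: "no_leading_zero (b' @ zeros j @ s)" "b' \<noteq> []" using *(3) by (cases b'; auto)+
    let ?q = "c @ One # y @ Zero # zeros i @ b'"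
    have "slide q ?q" using slide.slide[OF *(1,2), of b' c] h p(1) p'(1) b'(1) by auto
    then have dq: "dyck_word ?q" using qs(1) slide_dyck_word_iff by blast
    have "v = One # ?q @ Zero # s" using * b' c0 by simp
    then have "sharp w v = A @ ?q @ zeros j @ s"
      unfolding w using sharp_eq[OF A dq qs(2)] by simp
    then show ?thesis
      using slide.slide[OF *(1,2) h(1), of "A @ c"] su p(1)[symmetric] p'(1) b'(1) by simp
  next
    assume p: "c @ zeros i = q @ p" "p @ One # y @ Zero # b = Zero # s"
    then obtain s1 where s1: "p = Zero # s1" "s = s1 @ One # y @ Zero # b" by (cases p) auto
    \<comment> \<open>Reversal brings the crossed zeros to the front, where
      \<open>zeros_append_eq_append\<close> applies.\<close>
    have "zeros i @ rev c = rev s1 @ Zero # rev q"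
      using arg_cong[OF p(1), of rev] s1(1) by simp
    then show ?thesis
    proof (cases rule: zeros_append_eq_append)
      case (1 b')
      then have s1': "s1 = rev b' @ zeros i" and c: "c = q @ Zero # rev b'"
        by (metis rev_append rev_replicate rev_rev_ident, metis append.assoc append_Cons append_Nil rev.simps(2) rev_append rev_rev_ident)
      let ?s = "rev b' @ One # y @ Zero # zeros i @ b"
      have s: "s = rev b' @ zeros i @ One # y @ Zero # b" using s1 s1' by simp
      have "slide s ?s" unfolding s using *(1-3) by (rule slide.slide)
      then have ds: "dyck_word ?s" using qs(2) slide_dyck_word_iff by blast
      have "v = One # q @ Zero # ?s" using * c c0 by simp
      then have "sharp w v = A @ q @ zeros j @ ?s"
        unfolding w using sharp_eq[OF A qs(1) ds] by simp
      then show ?thesis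
        using slide.slide[OF *(1,2,3), of "A @ q @ zeros j @ rev b'"] su s by simp
    next
      case (2 i')
      \<comment> \<open>A Dyck word cannot begin with a zero, so \<open>s1\<close> is empty: the
        arch opens \<open>s\<close> and crosses the \<open>Zero\<close> after
        \<open>q\<close>.\<close>
      then have "s1 = zeros i'" by (metis rev_replicate rev_rev_ident)
      with qs(2) s1(2) have "i' = 0" using dyck_word_append_zeros by blast
      with \<open>s1 = zeros i'\<close> have s: "s = One # y @ Zero # b" using s1 by simp
      obtain k where k: "i = Suc k" using *(1) by (cases i) auto
      have "c @ zeros k = q"
        using p(1) s1(1) \<open>s1 = zeros i'\<close> \<open>i' = 0\<close> k by (simp flip: replicate_append_same)
      have q: "q = c @ zeros k" using \<open>c @ zeros k = q\<close> by simp
      let ?q = "c @ One # y @ Zero # zeros k"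
      have "dyck_word ?q" using qs(1) *(2) unfolding q
        by (cases "run 0 c") (auto simp: run_dyck_word split: if_splits)
      moreover have "dyck_word b" using qs(2) *(2) by (simp add: s run_dyck_word)
      moreover have "v = One # ?q @ Zero # b" using * c0 k by (simp add: replicate_app_Cons_same)
      ultimately have "sharp w v = A @ ?q @ zeros j @ b"
        unfolding w using sharp_eq[OF A, of ?q b] by simp
      then show ?thesis
        using slide.slide[OF _ *(2,3), of "k + j" "A @ c"] su s q j by (simp add: replicate_add)
    qed
  qed
qed

text \<open>The cases follow where the moved arch begins: in \<open>s\<close>, in \<open>q\<close>
  or in \<open>A\<close>. Since \<open>b\<close> cannot begin with \<open>Zero\<close>, a slide
  whose crossed zeros reach into \<open>zeros j\<close> must cross all that is left of it; this
  makes its source a product.\<close>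

lemma slide_to_sharp:
  assumes "slide w (sharp v1 v2)" "v1 \<in> dyck m" "m \<ge> 1" "v2 \<in> dyck n" "n \<ge> 1"
  shows "\<exists>w1 w2. w = sharp w1 w2 \<and> (slide w1 v1 \<and> w2 = v2 \<or> w1 = v1 \<and> slide w2 v2)"
proof -
  obtain q s where v2: "v2 = One # q @ Zero # s" and qs: "dyck_word q" "dyck_word s"
    using first_block[OF assms(4,5)] .
  obtain A j where v1: "v1 = A @ zeros j" and A: "ascent_part A j"
    using last_descent[OF assms(2,3)] by metis
  have s0: "no_leading_zero s" by (rule dyck_word_no_leading_zero) fact
  have sh: "sharp v1 v2 = A @ q @ zeros j @ s" unfolding v1 v2 using A qs by (rule sharp_eq)
  \<comment> \<open>\<open>left\<close> and \<open>right\<close> reduce the goal to a slide in one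
    factor and the matching shape of \<open>w\<close>.\<close>
  have left: ?thesis
    if "slide (B @ zeros k) v1" "B \<noteq> []" "last B = One" "w = B @ q @ zeros k @ s" for B k
  proof -
    have "dyck_word (B @ zeros k)" using that(1) assms(2) slide_dyck_iff dyck_iff by blast
    then have "ascent_part B k" using run_append_zeros_eq_0 that(2,3) by blast
    then show ?thesis
      using sharp_eq[OF _ qs, of B k] that(1,4) v2 by metis
  qed
  have right: ?thesis
    if "slide (One # p @ Zero # t) v2" "dyck_word p" "dyck_word t" "w = A @ p @ zeros j @ t" for p t
    using sharp_eq[OF A that(2,3)] that(1,4) v1 by metis
  from assms(1) obtain i y b c where *: "0 < i" "dyck_word y" "no_leading_zero b"
    "w = c @ zeros i @ One # y @ Zero # b" "A @ q @ zeros j @ s = c @ One # y @ Zero # zeros i @ b"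
    unfolding sh by cases blast
  from *(5) obtain a where "A = c @ a \<and> a @ q @ zeros j @ s = One # y @ Zero # zeros i @ b \<or>
      A @ a = c \<and> q @ zeros j @ s = a @ One # y @ Zero # zeros i @ b"
    unfolding append_eq_append_conv2 by blast
  then consider
      (before) "A @ a = c" "q @ zeros j @ s = a @ One # y @ Zero # zeros i @ b"
    | (after) a' where "A = c @ One # a'" "y @ Zero # zeros i @ b = a' @ q @ zeros j @ s"
    by (cases a) auto
  then show ?thesis
  proof cases
    case before
    from before(2) obtain p where
      "q = a @ p \<and> p @ zeros j @ s = One # y @ Zero # zeros i @ b \<or>
       q @ p = a \<and> zeros j @ s = p @ One # y @ Zero # zeros i @ b"
      unfolding append_eq_append_conv2 by blast
    then consider
        (in_s) "q @ p = a" "zeros j @ s = p @ One # y @ Zero # zeros i @ b"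
      | (in_q) p' where "q = a @ One # p'" "y @ Zero # zeros i @ b = p' @ zeros j @ s"
      using A by (cases p) (auto simp: Cons_eq_append_conv)
    then show ?thesis
    proof cases
      case in_s
      from in_s(2) obtain s' where s': "p = zeros j @ s'" "s = s' @ One # y @ Zero # zeros i @ b"
      proof (cases rule: zeros_append_eq_append)
        case (2 i')
        then show ?thesis by (cases "j - i'") auto
      qed (use that in blast)
      let ?t = "s' @ zeros i @ One # y @ Zero # b"
      have t: "slide ?t s" unfolding s' using *(1-3) by (rule slide.slide)
      then have "dyck_word ?t" using qs(2) slide_dyck_word_iff by blast
      moreover have "slide (One # q @ Zero # ?t) v2"
        using slide.slide[OF *(1-3), of "One # q @ Zero # s'"] v2 s'(2) by simp
      ultimately show ?thesis
        using right[of q ?t] qs(1) by (simp add: *(4) s'(1) flip: before(1) in_s(1))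
    next
      case in_q
      obtain h where "run (Suc h) p' = Some 0"
        using qs(1) in_q(1) by (cases "run 0 a") auto
      from arch_within[OF in_q(2) *(2) this] obtain q3 where
        q3: "p' = y @ Zero # q3" "zeros i @ b = q3 @ zeros j @ s" .
      \<comment> \<open>Either the crossed zeros end strictly inside \<open>q3\<close>, or
        \<open>q3\<close> consists of crossed zeros only.\<close>
      from q3(2) consider b' where "b' \<noteq> []" "q3 = zeros i @ b'" "b = b' @ zeros j @ s"
        | i' where "i' \<le> i" "q3 = zeros i'" "zeros (i - i') @ b = zeros j @ s"
      proof (cases rule: zeros_append_eq_append)
        case (1 b')
        then show ?thesis using that(1)[of b'] that(2)[of i] by (cases "b' = []") auto
      next
        case (2 i')
        then show ?thesis using that(2)[of i'] by simp
      qed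
      then show ?thesis
      proof cases
        case (1 b')
        then have b': "no_leading_zero (b' @ r)" for r using *(3) by auto
        let ?p = "a @ zeros i @ One # y @ Zero # b'"
        have "slide ?p q"
          using slide.slide[OF *(1,2), of b' a] b'[of "[]"] in_q(1) q3(1) 1(2) by simp
        then have "dyck_word ?p" using qs(1) slide_dyck_word_iff by blast
        moreover have "slide (One # ?p @ Zero # s) v2"
          using slide.slide[OF *(1,2) b', of "One # a"] v2 in_q(1) q3(1) 1(2) by simp
        ultimately show ?thesis
          using right[of ?p s] qs(2) *(4) before in_q 1 by simp
      next
        case (2 i')
        \<comment> \<open>All of \<open>zeros j\<close> is crossed together with the
          \<open>i'\<close> zeros ending \<open>q\<close>; in \<open>v2\<close> this is a slide
          across \<open>Suc i'\<close> zeros.\<close>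
        from zeros_append_cancel[OF 2(3) *(3) s0] 2(1) have i: "i = i' + j" "b = s" by auto
        let ?p = "a @ zeros i'" and ?t = "One # y @ Zero # s"
        have p: "dyck_word ?p"
          using qs(1) *(2) unfolding in_q(1) q3(1) 2(2)
          by (cases "run 0 a") (auto simp: run_dyck_word split: if_splits)
        moreover have "dyck_word ?t" using qs(2) *(2) by (simp add: run_dyck_word)
        moreover have "slide (One # ?p @ Zero # ?t) v2"
          using slide.slide[of "Suc i'" y s "One # a"] *(2) s0 v2 in_q(1) q3(1) 2(2)
          by (simp add: replicate_app_Cons_same)
        ultimately show ?thesis
          using right[of ?p ?t] *(4) before i by (simp add: replicate_add)
      qed
    qed
  next
    case after
    from after(2) obtain u where
      "y = a' @ u \<and> u @ Zero # zeros i @ b = q @ zeros j @ s \<or>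
       y @ u = a' \<and> Zero # zeros i @ b = u @ q @ zeros j @ s"
      unfolding append_eq_append_conv2 by blast
    then consider
        (inside) u where "y = a' @ u" "u @ Zero # zeros i @ b = q @ zeros j @ s"
      | (beyond) u' where "a' = y @ Zero # u'" "zeros i @ b = u' @ q @ zeros j @ s"
      by (cases u) auto
    then show ?thesis
    proof cases
      case inside
      obtain h where h: "run 0 c = Some h" using A after(1) by (cases "run 0 c") auto
      obtain l where l: "run 0 a' = Some l" using *(2) inside(1) by (cases "run 0 a'") auto
      have "run (Suc h) a' = Some (l + Suc h)" using run_shift[OF l, of "Suc h"] by simp
      \<comment> \<open>\<open>h\<close> is the height where the arch begins and \<open>l\<close>
        the height reached by \<open>a'\<close> inside it.\<close>
      then have "j = l + Suc h" using A after(1) h by simp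
      then have "l < j" by simp
      moreover have "run l u = Some 0" using *(2) inside(1) l by simp
      ultimately have u: "u = q @ zeros l" using arch_across inside(2) qs(1) by blast
      have "zeros j = zeros l @ zeros (j - l)" using \<open>l < j\<close> by (simp flip: replicate_add)
      \<comment> \<open>Once \<open>u\<close> has used \<open>l\<close> zeros, the
        \<open>Zero\<close> closing the arch and the \<open>i\<close> crossed zeros make up the rest
        of \<open>zeros j\<close>.\<close>
      then have "zeros (Suc i) @ b = zeros (j - l) @ s" using inside(2) u by simp
      from zeros_append_cancel[OF this *(3) s0] \<open>l < j\<close> have j: "j = l + Suc i" "b = s" by auto
      let ?B = "c @ zeros i @ One # a'"
      have "dyck_word (a' @ zeros l)" using l by simp
      from slide.slide[OF *(1) this, of "[]" c]
      have "slide (?B @ zeros (Suc l)) v1"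
        using after(1) v1 j(1)
        by (simp add: replicate_append_same replicate_add replicate_app_Cons_same)
      moreover have "last ?B = One" using A after(1) by simp
      ultimately show ?thesis
        using left[of ?B "Suc l"] *(4) inside(1) u j(2) by (simp add: replicate_app_Cons_same)
    next
      case beyond
      \<comment> \<open>\<open>A\<close> ends with \<open>One\<close>, hence so does
        \<open>u'\<close>, and the crossed zeros end strictly inside it.\<close>
      have ne: "\<And>k. u' \<noteq> zeros k"
        using A after(1) beyond(1) by (auto simp: last_replicate split: if_splits)
      from beyond(2) obtain b' where b': "u' = zeros i @ b'" "b = b' @ q @ zeros j @ s"
        by (cases rule: zeros_append_eq_append) (use ne in blast)+
      from b'(1) ne[of i] have "b' \<noteq> []" by auto
      with b'(2) *(3) have nb: "no_leading_zero (b' @ r)" for r by auto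
      let ?B = "c @ zeros i @ One # y @ Zero # b'"
      have "slide (?B @ zeros j) v1"
        using slide.slide[OF *(1,2) nb, of c "zeros j"] v1 after(1) beyond(1) b'(1) by simp
      moreover have "last ?B = One" using A after(1) beyond(1) b' \<open>b' \<noteq> []\<close> by simp
      ultimately show ?thesis
        using left[of ?B j] *(4) b'(2) by simp
    qed
  qed
qed

section \<open>Injectivity and size of products\<close>

lemma count_list_One_append:
  assumes "A @ r = B @ t" "count_list A One = count_list B One" "last A = One" "last B = One"
  shows "A = B"
proof -
  \<comment> \<open>A nonempty \<open>u\<close> would end with \<open>One\<close> and raise the
    count.\<close>
  have *: "u = []" if "count_list (P @ u) One = count_list P One" "last (P @ u) = One" for P u
    using that by (cases u rule: rev_cases) simp_all
  from assms(1) obtain u where "A = B @ u \<and> u @ r = t \<or> A @ u = B \<and> r = u @ t"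
    unfolding append_eq_append_conv2 by blast
  then show ?thesis
  proof (elim disjE conjE)
    assume u: "A = B @ u"
    have "u = []" using assms(2,3) unfolding u by (rule *)
    with u show ?thesis by simp
  next
    assume u: "A @ u = B"
    have "u = []" using assms(2,4) unfolding u[symmetric] by (intro *) simp_all
    with u show ?thesis by simp
  qed
qed

lemma sharp_inject:
  assumes "sharp u1 u2 = sharp v1 v2" "u1 \<in> dyck m" "v1 \<in> dyck m" "m \<ge> 1"
    "u2 \<in> dyck n" "v2 \<in> dyck n" "n \<ge> 1"
  shows "u1 = v1 \<and> u2 = v2"
proof -
  obtain A j where u1: "u1 = A @ zeros j" and A: "ascent_part A j" "j \<ge> 1"
    using last_descent[OF assms(2,4)] by metis
  obtain B k where v1: "v1 = B @ zeros k" and B: "ascent_part B k"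
    using last_descent[OF assms(3,4)] by metis
  obtain q s where u2: "u2 = One # q @ Zero # s" and qs: "dyck_word q" "dyck_word s"
    using first_block[OF assms(5,7)] .
  obtain p t where v2: "v2 = One # p @ Zero # t" and pt: "dyck_word p" "dyck_word t"
    using first_block[OF assms(6,7)] .
  have eq: "A @ q @ zeros j @ s = B @ p @ zeros k @ t"
    using assms(1) sharp_eq[OF A(1) qs] sharp_eq[OF B pt] u1 u2 v1 v2 by simp
  \<comment> \<open>All letters \<open>One\<close> of the left factor lie in its ascent
    part.\<close>
  have "count_list A One = m" "count_list B One = m"
    using assms(2,3) u1 v1 by (auto simp: dyck_def)
  then have AB: "A = B" using count_list_One_append[OF eq] A B by simp
  with A B have "k = j" by simp
  \<comment> \<open>As \<open>j\<close> is positive, a \<open>Zero\<close> follows \<open>q\<close>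
    and \<open>p\<close> and marks their ends.\<close>
  moreover obtain j' where "j = Suc j'" using A(2) by (cases j) auto
  ultimately have "q @ Zero # zeros j' @ s = p @ Zero # zeros j' @ t" using eq AB by simp
  from dyck_word_Zero_cancel[OF qs(1) pt(1) this] AB \<open>k = j\<close>
  show ?thesis by (simp add: u1 u2 v1 v2)
qed

lemma sharp_dyck:
  assumes "u \<in> dyck m" "v \<in> dyck n" "m \<ge> 1" "n \<ge> 1"
  shows "sharp u v \<in> dyck (m + n - 1)"
proof -
  obtain A j where u: "u = A @ zeros j" and A: "ascent_part A j"
    using last_descent[OF assms(1,3)] by metis
  obtain q s where v: "v = One # q @ Zero # s" and qs: "dyck_word q" "dyck_word s"
    using first_block[OF assms(2,4)] .
  show ?thesis
    using A qs assms sharp_eq[OF A qs] u v by (auto simp: dyck_iff run_dyck_word)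
qed

section \<open>The dexter order on products and the interval isomorphism\<close>

lemma slides_sharp_left:
  assumes "slide\<^sup>*\<^sup>* u v" "u \<in> dyck m" "m \<ge> 1" "w \<in> dyck n" "n \<ge> 1"
  shows "slide\<^sup>*\<^sup>* (sharp u w) (sharp v w)"
  using assms(1,2)
proof (induction rule: converse_rtranclp_induct)
  case (step x y)
  then have "slide (sharp x w) (sharp y w)" "y \<in> dyck m"
    using slide_sharp_left assms(3-5) slide_dyck_iff by blast+
  with step.IH show ?case by (meson converse_rtranclp_into_rtranclp)
qed simp

lemma slides_sharp_right:
  assumes "slide\<^sup>*\<^sup>* u v" "u \<in> dyck n" "n \<ge> 1" "w \<in> dyck m" "m \<ge> 1"
  shows "slide\<^sup>*\<^sup>* (sharp w u) (sharp w v)"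
  using assms(1,2)
proof (induction rule: converse_rtranclp_induct)
  case (step x y)
  then have "slide (sharp w x) (sharp w y)" "y \<in> dyck n"
    using slide_sharp_right assms(3-5) slide_dyck_iff by blast+
  with step.IH show ?case by (meson converse_rtranclp_into_rtranclp)
qed simp

lemma dexter_le_sharp:
  assumes "dexter_le m u1 v1" "dexter_le n u2 v2" "m \<ge> 1" "n \<ge> 1"
  shows "dexter_le (m + n - 1) (sharp u1 u2) (sharp v1 v2)"
proof -
  have d: "u1 \<in> dyck m" "v1 \<in> dyck m" "u2 \<in> dyck n" using assms by (auto simp: dexter_le_def)
  have "slide\<^sup>*\<^sup>* (sharp u1 u2) (sharp v1 u2)" "slide\<^sup>*\<^sup>* (sharp v1 u2) (sharp v1 v2)"
    using slides_sharp_left[of u1 v1 m u2 n] slides_sharp_right[of u2 v2 n v1 m] assms d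
    by (simp_all add: dexter_le_iff)
  then show ?thesis using sharp_dyck d assms(3,4) by (simp add: dexter_le_iff)
qed

text \<open>Products form a down-set: a path ending in a product is followed backwards, each slide
  being pulled back to one factor.\<close>

lemma dexter_le_to_sharp:
  assumes "dexter_le N w (sharp v1 v2)" "v1 \<in> dyck m" "m \<ge> 1" "v2 \<in> dyck n" "n \<ge> 1"
  shows "\<exists>w1 w2. w = sharp w1 w2 \<and> dexter_le m w1 v1 \<and> dexter_le n w2 v2"
proof -
  have "slide\<^sup>*\<^sup>* w (sharp v1 v2)" using assms(1) by (simp add: dexter_le_iff)
  then show ?thesis
  proof (induction rule: converse_rtranclp_induct)
    case base
    show ?case using assms by (auto simp: dexter_le_iff)
  next
    case (step x y)
    then obtain y1 y2 where y: "y = sharp y1 y2" "dexter_le m y1 v1" "dexter_le n y2 v2" by blast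
    then have d: "y1 \<in> dyck m" "y2 \<in> dyck n" by (auto simp: dexter_le_def)
    from slide_to_sharp[OF step.hyps(1)[unfolded y(1)] d(1) assms(3) d(2) assms(5)] obtain x1 x2 where
      x: "x = sharp x1 x2" "slide x1 y1 \<and> x2 = y2 \<or> x1 = y1 \<and> slide x2 y2" by blast
    from x(2) y(2,3) d have "dexter_le m x1 v1 \<and> dexter_le n x2 v2"
      unfolding dexter_le_iff
      using slide_dyck_iff by (auto intro: converse_rtranclp_into_rtranclp)
    with x(1) show ?case by blast
  qed
qed

text \<open>The down-set property yields some pair with product \<open>sharp u1 u2\<close>;
  injectivity identifies it with \<open>u1\<close> and \<open>u2\<close>.\<close>

lemma dexter_le_sharp_iff:
  assumes "u1 \<in> dyck m" "v1 \<in> dyck m" "m \<ge> 1" "u2 \<in> dyck n" "v2 \<in> dyck n" "n \<ge> 1"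
  shows "dexter_le (m + n - 1) (sharp u1 u2) (sharp v1 v2) \<longleftrightarrow> dexter_le m u1 v1 \<and> dexter_le n u2 v2"
proof
  assume "dexter_le (m + n - 1) (sharp u1 u2) (sharp v1 v2)"
  from dexter_le_to_sharp[OF this assms(2,3,5,6)] obtain w1 w2 where
    w: "sharp u1 u2 = sharp w1 w2" "dexter_le m w1 v1" "dexter_le n w2 v2" by blast
  then have "w1 \<in> dyck m" "w2 \<in> dyck n" by (auto simp: dexter_le_def)
  with w sharp_inject[OF w(1)] assms show "dexter_le m u1 v1 \<and> dexter_le n u2 v2" by auto
qed (use dexter_le_sharp assms in blast)

theorem theorem4p3:
  fixes m n :: nat and w1 w1' w2 w2' :: word
  assumes "m \<ge> 1" and "n \<ge> 1"
    and "dexter_le m w1 w1'" and "dexter_le n w2 w2'"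
  shows "poset_isomorphic
           (dexter_interval (m + n - 1) (sharp w1 w2) (sharp w1' w2'))
           (dexter_le (m + n - 1))
           (dexter_interval m w1 w1' \<times> dexter_interval n w2 w2')
           (rel_prod (dexter_le m) (dexter_le n))"
proof -
  let ?I = "dexter_interval (m + n - 1) (sharp w1 w2) (sharp w1' w2')"
  let ?J = "dexter_interval m w1 w1' \<times> dexter_interval n w2 w2'"
  \<comment> \<open>The product map goes from pairs to the product interval; its inverse is the
    isomorphism asked for.\<close>
  define g where "g = (\<lambda>(u, v). sharp u v)"
  have w: "w1 \<in> dyck m" "w1' \<in> dyck m" "w2 \<in> dyck n" "w2' \<in> dyck n"
    using assms by (auto simp: dexter_le_def)
  have J: "u \<in> dyck m \<and> v \<in> dyck n" if "(u, v) \<in> ?J" for u v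
    using that by (auto simp: dexter_interval_def dexter_le_def)
  have "inj_on g ?J"
  proof (rule inj_onI)
    fix x y assume xy: "x \<in> ?J" "y \<in> ?J" "g x = g y"
    obtain x1 x2 y1 y2 where x: "x = (x1, x2)" and y: "y = (y1, y2)" by (cases x, cases y)
    then have "sharp x1 x2 = sharp y1 y2" using xy(3) by (simp add: g_def)
    from sharp_inject[OF this, of m n] J[of x1 x2] J[of y1 y2] xy(1,2) assms(1,2)
    show "x = y" unfolding x y by blast
  qed
  moreover have "g ` ?J = ?I"
  proof (intro equalityI subsetI)
    fix x assume "x \<in> g ` ?J"
    then obtain p where "p \<in> ?J" "x = g p" by blast
    then obtain u v where uv: "(u, v) \<in> ?J" "x = sharp u v" by (cases p) (simp add: g_def)
    with J[OF uv(1)] show "x \<in> ?I"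
      using dexter_le_sharp assms(1,2) by (auto simp: dexter_interval_def)
  next
    fix x assume "x \<in> ?I"
    then have x: "dexter_le (m + n - 1) (sharp w1 w2) x" "dexter_le (m + n - 1) x (sharp w1' w2')"
      by (auto simp: dexter_interval_def)
    \<comment> \<open>The upper bound makes \<open>x\<close> a product; the lower bound then splits
      into bounds for the factors.\<close>
    from dexter_le_to_sharp[OF x(2) w(2) assms(1) w(4) assms(2)] obtain u v where
      uv: "x = sharp u v" "dexter_le m u w1'" "dexter_le n v w2'" by blast
    then have "u \<in> dyck m" "v \<in> dyck n" by (auto simp: dexter_le_def)
    with x(1) uv have "(u, v) \<in> ?J"
      using dexter_le_sharp_iff w assms(1,2) by (auto simp: dexter_interval_def)
    moreover have "x = g (u, v)" using uv(1) by (simp add: g_def)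
    ultimately show "x \<in> g ` ?J" by blast
  qed
  ultimately have bij: "bij_betw g ?J ?I" by (simp add: bij_betw_def)
  define f where "f = inv_into ?J g"
  have f: "bij_betw f ?I ?J" unfolding f_def using bij by (rule bij_betw_inv_into)
  have "dexter_le (m + n - 1) x y \<longleftrightarrow> rel_prod (dexter_le m) (dexter_le n) (f x) (f y)"
    if "x \<in> ?I" "y \<in> ?I" for x y
  proof -
    obtain x1 x2 y1 y2 where fx: "f x = (x1, x2)" and fy: "f y = (y1, y2)" by fastforce
    have "(x1, x2) \<in> ?J" "(y1, y2) \<in> ?J"
      using f that fx fy by (metis bij_betwE)+
    moreover have "g (f x) = x" "g (f y) = y"
      using bij_betw_inv_into_right[OF bij] that unfolding f_def by blast+
    then have "sharp x1 x2 = x" "sharp y1 y2 = y" by (simp_all add: fx fy g_def)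
    ultimately show ?thesis
      using dexter_le_sharp_iff[of x1 m y1 x2 n y2] J[of x1 x2] J[of y1 y2] assms(1,2)
      by (simp add: fx fy)
  qed
  with f show ?thesis unfolding poset_isomorphic_def by blast
qed

end
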